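(* Let $L$ be a sup-lattice and for $l\in L$ let $C_l=\{l'\in L\mid l\vee l'=\top\text{ and }l'\neq\bot\}$. Then there is an isomorphism of functors of $X$ $$\Delta[L^{[X]}]\cong\sum_{l\in L}C_l\cdot D(l)^{[X]}.$$
   Context: A sup-lattice is a partially ordered set in which every subset has a supremum; $\bot$ and $\top$ are its bottom and top elements. For $l\in L$, $D(l)=\{l'\in L\mid l'\le l\}$ is the down-set of $l$, itself a sup-lattice with top element $l$. The normalized exponential functor with base $L$ is the functor $\mathbf{Set}\to\mathbf{Set}$, $X\mapsto L^{[X]}=\{\lambda \colon X\to L\mid\bigvee_{x\in X}\lambda(x)=\top\}$, given on a function $f \colon X\to Y$ by $L^{[f]}(\lambda)(y)=\bigvee_{f(x)=y}\lambda(x)$. It is taut, i.e. preserves pullback squares in which one leg is a monomorphism. For a set $C$ and a functor $F$, $C\cdot F$ is the functor $X\mapsto C\times F(X)$ (the coproduct of $C$ copies of $F$). For a taut functor $F \colon \mathbf{Set}\to\mathbf{Set}$, with $j_X \colon X\to X+1$ the coproduct injection, $\Delta[F](X)=F(X+1)\setminus\mathrm{Im}\,F(j_X)$, and $\Delta[F](f)$ is the restriction of $F(f+1)$ (which does restrict, because $F$ is taut). *)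

theory Defs
  imports "HOL-Algebra.Complete_Lattice" "HOL-Library.FuncSet"
begin

section \<open>Sup-lattices\<close>

locale sup_lattice = partial_order L for L (structure) +
  assumes sup_exists: "A \<subseteq> carrier L \<Longrightarrow> \<exists>s. least L s (Upper L A)"

definition down_set :: "('l, 'm) gorder_scheme \<Rightarrow> 'l \<Rightarrow> ('l, 'm) gorder_scheme" where
  "down_set L l = L\<lparr>carrier := {l' \<in> carrier L. l' \<sqsubseteq>\<^bsub>L\<^esub> l}\<rparr>"


section \<open>Functors from sets to sets\<close>

text \<open>
  The objects of the source category are the subsets of a type \<open>'u\<close>, those of the
  target category the subsets of a type \<open>'v\<close>. A morphism \<open>X \<rightarrow> Y\<close> is a member
  of \<open>X \<rightarrow>\<^sub>E Y\<close>, so that equality of morphisms is equality in HOL. \<open>fmap F X Y f\<close> is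
  meaningful for \<open>f \<in> X \<rightarrow>\<^sub>E Y\<close> only.
\<close>

record ('u, 'v) set_functor =
  fobj :: "'u set \<Rightarrow> 'v set"
  fmap :: "'u set \<Rightarrow> 'u set \<Rightarrow> ('u \<Rightarrow> 'u) \<Rightarrow> 'v \<Rightarrow> 'v"

definition is_functor :: "('u, 'v) set_functor \<Rightarrow> bool" where
  "is_functor F \<longleftrightarrow>
     (\<forall>X Y. \<forall>f \<in> X \<rightarrow>\<^sub>E Y. fmap F X Y f \<in> fobj F X \<rightarrow>\<^sub>E fobj F Y) \<and>
     (\<forall>X. fmap F X X (\<lambda>x\<in>X. x) = (\<lambda>a\<in>fobj F X. a)) \<and>
     (\<forall>X Y Z. \<forall>f \<in> X \<rightarrow>\<^sub>E Y. \<forall>g \<in> Y \<rightarrow>\<^sub>E Z.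
        fmap F X Z (compose X g f) = compose (fobj F X) (fmap F Y Z g) (fmap F X Y f))"

definition functor_iso :: "('u, 'v) set_functor \<Rightarrow> ('u, 'w) set_functor \<Rightarrow> bool" where
  "functor_iso F G \<longleftrightarrow> is_functor F \<and> is_functor G \<and>
     (\<exists>\<phi>. (\<forall>X. bij_betw (\<phi> X) (fobj F X) (fobj G X)) \<and>
          (\<forall>X Y. \<forall>f \<in> X \<rightarrow>\<^sub>E Y. \<forall>a \<in> fobj F X.
             \<phi> Y (fmap F X Y f a) = fmap G X Y f (\<phi> X a)))"

definition functor_sum :: "'i set \<Rightarrow> ('i \<Rightarrow> ('u, 'v) set_functor) \<Rightarrow> ('u, 'i \<times> 'v) set_functor" where
  "functor_sum I F =
     \<lparr> fobj = \<lambda>X. (SIGMA i:I. fobj (F i) X),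
       fmap = \<lambda>X Y f. \<lambda>(i, a) \<in> (SIGMA i:I. fobj (F i) X). (i, fmap (F i) X Y f a) \<rparr>"

definition copower :: "'c set \<Rightarrow> ('u, 'v) set_functor \<Rightarrow> ('u, 'c \<times> 'v) set_functor" where
  "copower C F =
     \<lparr> fobj = \<lambda>X. C \<times> fobj F X,
       fmap = \<lambda>X Y f. \<lambda>(c, a) \<in> C \<times> fobj F X. (c, fmap F X Y f a) \<rparr>"


section \<open>The coproduct \<open>X + 1\<close> and the difference operator\<close>

text \<open>
  For \<open>X + 1\<close> to be an object again, \<open>'u\<close> is equipped with an injection \<open>\<iota>\<close> and a point
  \<open>p\<close> outside its range, and \<open>X + 1\<close> is the disjoint union of \<open>\<iota> ` X\<close> and \<open>{p}\<close>.
  Such \<open>\<iota>\<close> and \<open>p\<close> exist exactly when \<open>'u\<close> is infinite.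
\<close>

definition plus_one :: "('u \<Rightarrow> 'u) \<Rightarrow> 'u \<Rightarrow> 'u set \<Rightarrow> 'u set" where
  "plus_one \<iota> p X = insert p (\<iota> ` X)"

definition plus_one_inj :: "('u \<Rightarrow> 'u) \<Rightarrow> 'u set \<Rightarrow> 'u \<Rightarrow> 'u" where
  "plus_one_inj \<iota> X = (\<lambda>x\<in>X. \<iota> x)"

definition plus_one_map :: "('u \<Rightarrow> 'u) \<Rightarrow> 'u \<Rightarrow> 'u set \<Rightarrow> ('u \<Rightarrow> 'u) \<Rightarrow> 'u \<Rightarrow> 'u" where
  "plus_one_map \<iota> p X f =
     (\<lambda>z \<in> plus_one \<iota> p X. if z = p then p else \<iota> (f (the_inv_into X \<iota> z)))"

text \<open>
  The restriction below is a morphism between the right sets if \<open>F\<close> is taut; for arbitrary \<open>F\<close> it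
  need not be, and then \<open>Delta \<iota> p F\<close> is not a functor.
\<close>

definition Delta :: "('u \<Rightarrow> 'u) \<Rightarrow> 'u \<Rightarrow> ('u, 'v) set_functor \<Rightarrow> ('u, 'v) set_functor" where
  "Delta \<iota> p F =
     (let D = (\<lambda>X. fobj F (plus_one \<iota> p X) -
                   fmap F X (plus_one \<iota> p X) (plus_one_inj \<iota> X) ` fobj F X)
      in \<lparr> fobj = D,
           fmap = \<lambda>X Y f. restrict
             (fmap F (plus_one \<iota> p X) (plus_one \<iota> p Y) (plus_one_map \<iota> p X f)) (D X) \<rparr>)"


section \<open>The normalized exponential functor\<close>

definition normexp_obj :: "('l, 'm) gorder_scheme \<Rightarrow> 'u set \<Rightarrow> ('u \<Rightarrow> 'l) set" where
  "normexp_obj L X = {w \<in> X \<rightarrow>\<^sub>E carrier L. \<Squnion>\<^bsub>L\<^esub>(w ` X) = \<top>\<^bsub>L\<^esub>}"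

definition normexp :: "('l, 'm) gorder_scheme \<Rightarrow> ('u, 'u \<Rightarrow> 'l) set_functor" where
  "normexp L =
     \<lparr> fobj = normexp_obj L,
       fmap = \<lambda>X Y f. \<lambda>w \<in> normexp_obj L X. \<lambda>y\<in>Y. \<Squnion>\<^bsub>L\<^esub>(w ` {x \<in> X. f x = y}) \<rparr>"

definition complement_set :: "('l, 'm) gorder_scheme \<Rightarrow> 'l \<Rightarrow> 'l set" where
  "complement_set L l = {l' \<in> carrier L. l \<squnion>\<^bsub>L\<^esub> l' = \<top>\<^bsub>L\<^esub> \<and> l' \<noteq> \<bottom>\<^bsub>L\<^esub>}"

end

theory Submission
  imports Defs
begin

text \<open>
  The inclusion \<open>X \<rightarrow> X + 1\<close> extends a weight function by the empty supremum \<open>\<bottom>\<close> at the new point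
  \<open>p\<close>, so an element of the difference is a normalized \<open>w\<close> on \<open>X + 1\<close> with \<open>w p \<noteq> \<bottom>\<close>. It is
  determined by \<open>c = w p\<close> and its restriction \<open>v\<close> to \<open>X\<close>. With \<open>l\<close> the supremum of \<open>v\<close>,
  normalization of \<open>w\<close> reads \<open>l \<squnion> c = \<top>\<close>, and \<open>v\<close> is a normalized function with values in
  the down-set of \<open>l\<close>. Since \<open>f + 1\<close> has fibre \<open>{p}\<close> over \<open>p\<close> and preserves suprema over \<open>X\<close>,
  neither \<open>l\<close> nor \<open>c\<close> changes along \<open>f\<close>, which gives naturality.
\<close>

section \<open>Suprema in sup-lattices and their down-sets\<close>

text \<open>The infimum of a set is the supremum of its lower bounds, so arbitrary suprema already
  give all infima. This makes the library's join, top and bottom, with their lemmas, available for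
  \<open>L\<close> and later for its down-sets.\<close>

sublocale sup_lattice \<subseteq> complete_lattice
proof (rule complete_latticeI)
  fix A
  assume A: "A \<subseteq> carrier L"
  obtain s where s: "least L s (Upper L (Lower L A))"
    using sup_exists[of "Lower L A"] by auto
  have "greatest L s (Lower L A)"
  proof (rule greatest_LowerI)
    show "s \<sqsubseteq> x" if "x \<in> A" for x
      using s A that by (intro least_le[OF s]) (auto intro!: Upper_memI)
    show "y \<sqsubseteq> s" if "y \<in> Lower L A" for y
      using s that by (auto intro: least_Upper_above)
  qed (use A s in auto)
  then show "\<exists>i. greatest L i (Lower L A)" ..
qed (rule sup_exists)

context complete_lattice
begin

lemma sup_eqI:
  assumes "A \<subseteq> carrier L" "z \<in> carrier L" "\<And>x. x \<in> A \<Longrightarrow> x \<sqsubseteq> z"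
    and "\<And>y. y \<in> carrier L \<Longrightarrow> (\<And>x. x \<in> A \<Longrightarrow> x \<sqsubseteq> y) \<Longrightarrow> z \<sqsubseteq> y"
  shows "\<Squnion>A = z"
proof (rule le_antisym)
  show "\<Squnion>A \<sqsubseteq> z"
    using assms(1-3) by (rule sup_least)
  show "z \<sqsubseteq> \<Squnion>A"
    using assms(1) by (intro assms(4)) (auto intro: sup_upper)
qed (use assms in auto)

text \<open>Both sides have the same upper bounds. This associativity of suprema underlies every
  computation with fibres below.\<close>

lemma sup_UN:
  assumes "\<And>i. i \<in> I \<Longrightarrow> A i \<subseteq> carrier L"
  shows "\<Squnion>(\<Union>i\<in>I. A i) = \<Squnion>((\<lambda>i. \<Squnion>(A i)) ` I)"
proof (rule sup_eqI)
  show "x \<sqsubseteq> \<Squnion>((\<lambda>i. \<Squnion>(A i)) ` I)" if "x \<in> (\<Union>i\<in>I. A i)" for x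
  proof -
    from that obtain i where i: "i \<in> I" "x \<in> A i" by blast
    have "x \<sqsubseteq> \<Squnion>(A i)" "\<Squnion>(A i) \<sqsubseteq> \<Squnion>((\<lambda>i. \<Squnion>(A i)) ` I)"
      using i assms by (auto intro!: sup_upper)
    then show ?thesis
      using i assms by (rule_tac le_trans[of _ "\<Squnion>(A i)"]) (auto intro!: sup_closed)
  qed
  show "\<Squnion>((\<lambda>i. \<Squnion>(A i)) ` I) \<sqsubseteq> y"
    if "y \<in> carrier L" "\<And>x. x \<in> (\<Union>i\<in>I. A i) \<Longrightarrow> x \<sqsubseteq> y" for y
    using that assms by (intro sup_least) (auto intro!: sup_least)
qed (use assms in \<open>auto intro!: sup_closed\<close>)

text \<open>The fibres of \<open>f\<close> over \<open>Y\<close> cover \<open>X\<close>, and empty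
  fibres contribute nothing. Pushing a function forward along \<open>f\<close> therefore keeps its
  total supremum: this gives preservation of normalization, and later the invariance of the index
  \<open>l\<close>.\<close>

lemma sup_fibres:
  assumes "w \<in> X \<rightarrow> carrier L" "f \<in> X \<rightarrow> Y"
  shows "\<Squnion>((\<lambda>y. \<Squnion>(w ` {x \<in> X. f x = y})) ` Y) = \<Squnion>(w ` X)"
proof -
  have "w ` X = (\<Union>y\<in>Y. w ` {x \<in> X. f x = y})"
    using assms by auto
  then show ?thesis
    using assms by (simp add: sup_UN image_subset_iff Pi_iff)
qed

end

context sup_lattice
begin

lemma down_set_partial_order: "partial_order (down_set L l)"
proof -
  interpret D: weak_partial_order "down_set L l"
    unfolding down_set_def by (rule weak_partial_order_subset) (auto intro: weak_partial_order_axioms)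
  show ?thesis
    \<comment> \<open>Only the carrier changes in \<open>down_set L l\<close>, so the equivalence
      stored in the record is still equality.\<close>
    by standard (simp add: down_set_def eq_is_equal)
qed

text \<open>Elements below \<open>l\<close> have their supremum below \<open>l\<close>, so the
  supremum formed in \<open>L\<close> stays in the down-set; this includes the empty
  supremum.\<close>

lemma least_down_set:
  assumes "l \<in> carrier L" "A \<subseteq> carrier (down_set L l)"
  shows "least (down_set L l) (\<Squnion>A) (Upper (down_set L l) A)"
  using assms
  by (intro least_UpperI) (auto simp: down_set_def Upper_def subset_iff intro!: sup_upper sup_least)

lemma down_set_sup_lattice:
  assumes "l \<in> carrier L"
  shows "sup_lattice (down_set L l)"
  using down_set_partial_order least_down_set[OF assms]
  by (auto simp: sup_lattice_def sup_lattice_axioms_def)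

lemma sup_down_set:
  assumes "l \<in> carrier L" "A \<subseteq> carrier (down_set L l)"
  shows "\<Squnion>\<^bsub>down_set L l\<^esub>A = \<Squnion>A"
proof -
  interpret D: sup_lattice "down_set L l"
    by (rule down_set_sup_lattice) fact
  show ?thesis
    using assms by (intro D.least_unique[OF D.sup_lub least_down_set])
qed

lemma top_down_set:
  assumes "l \<in> carrier L"
  shows "\<top>\<^bsub>down_set L l\<^esub> = l"
proof -
  interpret D: sup_lattice "down_set L l"
    by (rule down_set_sup_lattice) fact
  have "greatest (down_set L l) l (carrier (down_set L l))"
    using assms by (simp add: greatest_def down_set_def)
  then show ?thesis
    by (rule D.greatest_unique[OF D.top_greatest])
qed

text \<open>A function with supremum \<open>l\<close> automatically takes its values below
  \<open>l\<close>. Hence the sets on the right, for varying \<open>l\<close>, sort all functions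
  from \<open>X\<close> to \<open>L\<close> by their supremum.\<close>

lemma normexp_obj_down_set:
  assumes "l \<in> carrier L"
  shows "normexp_obj (down_set L l) X = {w \<in> X \<rightarrow>\<^sub>E carrier L. \<Squnion>(w ` X) = l}"
proof -
  have "w ` X \<subseteq> carrier (down_set L l)" if "w \<in> X \<rightarrow>\<^sub>E carrier L" "\<Squnion>(w ` X) = l" for w
    using that by (auto simp: down_set_def PiE_iff intro!: sup_upper)
  moreover have "w ` X \<subseteq> carrier (down_set L l)" "w \<in> X \<rightarrow>\<^sub>E carrier L"
    if "w \<in> X \<rightarrow>\<^sub>E carrier (down_set L l)" for w
    using that by (auto simp: down_set_def)
  ultimately show ?thesis
    using assms unfolding normexp_obj_def
    by (intro Collect_cong) (metis sup_down_set top_down_set image_subset_iff PiE_iff)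
qed

end


section \<open>Functoriality of the constructions\<close>

text \<open>Normalization is preserved by \<open>sup_fibres\<close>, and the fibres of an identity
  are singletons. For composites, \<open>sup_UN\<close> is applied to a decomposition of
  fibres.\<close>

lemma (in sup_lattice) is_functor_normexp: "is_functor (normexp L)"
  unfolding is_functor_def
proof (intro conjI allI ballI)
  fix X Y :: "'u set" and f
  assume f: "f \<in> X \<rightarrow>\<^sub>E Y"
  then show "fmap (normexp L) X Y f \<in> fobj (normexp L) X \<rightarrow>\<^sub>E fobj (normexp L) Y"
    using sup_fibres[of _ X f Y]
    by (auto simp: normexp_def normexp_obj_def PiE_iff Pi_iff image_subset_iff)
next
  fix X :: "'u set"
  have "(\<lambda>y\<in>X. \<Squnion>(w ` {x \<in> X. (\<lambda>x\<in>X. x) x = y})) = w" if "w \<in> X \<rightarrow>\<^sub>E carrier L" for w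
  proof
    fix y
    have "{x \<in> X. (\<lambda>x\<in>X. x) x = y} = {y}" if "y \<in> X"
      using that by auto
    then show "(\<lambda>y\<in>X. \<Squnion>(w ` {x \<in> X. (\<lambda>x\<in>X. x) x = y})) y = w y"
      using that by (cases "y \<in> X") (auto simp: PiE_iff extensional_def)
  qed
  then show "fmap (normexp L) X X (\<lambda>x\<in>X. x) = (\<lambda>a\<in>fobj (normexp L) X. a)"
    unfolding normexp_def set_functor.select_convs
    by (intro restrict_ext) (simp only: normexp_obj_def mem_Collect_eq)
next
  fix X Y Z :: "'u set" and f g
  assume f: "f \<in> X \<rightarrow>\<^sub>E Y" and g: "g \<in> Y \<rightarrow>\<^sub>E Z"
  have mem: "(\<lambda>y\<in>Y. \<Squnion>(w ` {x \<in> X. f x = y})) \<in> normexp_obj L Y" if "w \<in> normexp_obj L X" for w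
    using that f sup_fibres[of w X f Y] by (auto simp: normexp_obj_def PiE_iff Pi_iff image_subset_iff)
  have eq: "\<Squnion>(w ` {x \<in> X. compose X g f x = z}) =
      \<Squnion>((\<lambda>y\<in>Y. \<Squnion>(w ` {x \<in> X. f x = y})) ` {y \<in> Y. g y = z})"
    if w: "w \<in> normexp_obj L X" for w z
  proof -
    \<comment> \<open>The fibre of the composite over \<open>z\<close> is the union of the fibres of
      \<open>f\<close> over the points of the fibre of \<open>g\<close>.\<close>
    have "w ` {x \<in> X. compose X g f x = z} = (\<Union>y\<in>{y \<in> Y. g y = z}. w ` {x \<in> X. f x = y})"
      using f by (auto simp: compose_def)
    also have "\<Squnion>\<dots> = \<Squnion>((\<lambda>y. \<Squnion>(w ` {x \<in> X. f x = y})) ` {y \<in> Y. g y = z})"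
      using w by (intro sup_UN) (auto simp: normexp_obj_def)
    also have "(\<lambda>y. \<Squnion>(w ` {x \<in> X. f x = y})) ` {y \<in> Y. g y = z} =
        (\<lambda>y\<in>Y. \<Squnion>(w ` {x \<in> X. f x = y})) ` {y \<in> Y. g y = z}"
      by (intro image_cong) auto
    finally show ?thesis .
  qed
  show "fmap (normexp L) X Z (compose X g f) =
      compose (fobj (normexp L) X) (fmap (normexp L) Y Z g) (fmap (normexp L) X Y f)"
    by (rule ext) (simp add: normexp_def compose_def[of "normexp_obj L X"] mem eq)
qed

lemma is_functor_sum:
  fixes F :: "'i \<Rightarrow> ('u, 'v) set_functor"
  assumes "\<And>i. i \<in> I \<Longrightarrow> is_functor (F i)"
  shows "is_functor (functor_sum I F)"
proof -
  have 1: "fmap (F i) X Y f a \<in> fobj (F i) Y" if "i \<in> I" "f \<in> X \<rightarrow>\<^sub>E Y" "a \<in> fobj (F i) X" for i X Y f a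
    using assms[OF that(1)] that unfolding is_functor_def by blast
  have 2: "fmap (F i) X X (\<lambda>x\<in>X. x) a = a" if "i \<in> I" "a \<in> fobj (F i) X" for i X a
    using assms[OF that(1)] that unfolding is_functor_def by simp
  have 3: "fmap (F i) X Z (compose X g f) a = fmap (F i) Y Z g (fmap (F i) X Y f a)"
    if "i \<in> I" "f \<in> X \<rightarrow>\<^sub>E Y" "g \<in> Y \<rightarrow>\<^sub>E Z" "a \<in> fobj (F i) X" for i X Y Z f g a
    using assms[OF that(1)] that unfolding is_functor_def by (simp add: compose_eq)
  show ?thesis
    unfolding is_functor_def
  proof (intro conjI allI ballI)
    fix X Y :: "'u set" and f
    assume "f \<in> X \<rightarrow>\<^sub>E Y"
    then show "fmap (functor_sum I F) X Y f \<in> fobj (functor_sum I F) X \<rightarrow>\<^sub>E fobj (functor_sum I F) Y"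
      by (auto simp: functor_sum_def 1)
  next
    fix X :: "'u set"
    show "fmap (functor_sum I F) X X (\<lambda>x\<in>X. x) = (\<lambda>a\<in>fobj (functor_sum I F) X. a)"
      unfolding functor_sum_def set_functor.select_convs
      by (intro restrict_ext) (clarsimp simp only: 2 mem_Sigma_iff prod.case prod.inject simp_thms)
  next
    fix X Y Z :: "'u set" and f g
    assume "f \<in> X \<rightarrow>\<^sub>E Y" "g \<in> Y \<rightarrow>\<^sub>E Z"
    then show "fmap (functor_sum I F) X Z (compose X g f) =
        compose (fobj (functor_sum I F) X) (fmap (functor_sum I F) Y Z g) (fmap (functor_sum I F) X Y f)"
      unfolding functor_sum_def set_functor.select_convs compose_def[of "SIGMA i:I. fobj (F i) X"]
      by (intro restrict_ext) (auto simp: 1 3)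
  qed
qed

lemma is_functor_copower:
  assumes "is_functor F"
  shows "is_functor (copower C F)"
proof -
  have "copower C F = functor_sum C (\<lambda>_. F)"
    by (simp add: copower_def functor_sum_def)
  then show ?thesis
    using is_functor_sum[of C "\<lambda>_. F"] assms by simp
qed

section \<open>Functoriality of adjoining a point and of the difference operator\<close>

locale disjoint_point =
  fixes \<iota> :: "'u \<Rightarrow> 'u" and p :: 'u
  assumes inj: "inj \<iota>" and p_notin: "p \<notin> range \<iota>"
begin

lemma inj_eq [simp]: "\<iota> x = \<iota> y \<longleftrightarrow> x = y"
  using inj by (auto dest: injD)

lemma p_neq [simp]: "p \<noteq> \<iota> x" "\<iota> x \<noteq> p"
  using p_notin by auto

lemma the_inv_into_\<iota> [simp]: "x \<in> X \<Longrightarrow> the_inv_into X \<iota> (\<iota> x) = x"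
  using inj by (intro the_inv_into_f_f) (auto intro: inj_on_subset)

lemma plus_one_map_p [simp]: "plus_one_map \<iota> p X f p = p"
  by (simp add: plus_one_map_def plus_one_def)

lemma plus_one_map_\<iota> [simp]: "x \<in> X \<Longrightarrow> plus_one_map \<iota> p X f (\<iota> x) = \<iota> (f x)"
  by (simp add: plus_one_map_def plus_one_def)

lemma plus_one_map_PiE: "f \<in> X \<rightarrow>\<^sub>E Y \<Longrightarrow> plus_one_map \<iota> p X f \<in> plus_one \<iota> p X \<rightarrow>\<^sub>E plus_one \<iota> p Y"
  unfolding plus_one_map_def plus_one_def by auto

text \<open>A map out of a coproduct is determined on the two summands. Both functor laws for
  \<open>X + 1\<close> follow from this uniqueness.\<close>

lemma plus_one_map_eqI:
  assumes "g \<in> extensional (plus_one \<iota> p X)" "g p = p" "\<And>x. x \<in> X \<Longrightarrow> g (\<iota> x) = \<iota> (f x)"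
  shows "plus_one_map \<iota> p X f = g"
proof (rule extensionalityI[OF _ assms(1)])
  show "plus_one_map \<iota> p X f \<in> extensional (plus_one \<iota> p X)"
    unfolding plus_one_map_def by simp
qed (use assms in \<open>auto simp: plus_one_def\<close>)

lemma plus_one_map_id: "plus_one_map \<iota> p X (\<lambda>x\<in>X. x) = (\<lambda>z\<in>plus_one \<iota> p X. z)"
  by (rule plus_one_map_eqI) (auto simp: plus_one_def)

lemma plus_one_map_compose:
  assumes "f \<in> X \<rightarrow>\<^sub>E Y"
  shows "plus_one_map \<iota> p X (compose X g f) =
    compose (plus_one \<iota> p X) (plus_one_map \<iota> p Y g) (plus_one_map \<iota> p X f)"
proof (rule plus_one_map_eqI)
  fix x
  assume x: "x \<in> X"
  then have "f x \<in> Y" "\<iota> x \<in> plus_one \<iota> p X"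
    using assms by (auto simp: plus_one_def)
  then show "compose (plus_one \<iota> p X) (plus_one_map \<iota> p Y g) (plus_one_map \<iota> p X f) (\<iota> x) =
      \<iota> (compose X g f x)"
    using x by (simp add: compose_eq)
qed (simp_all add: compose_def plus_one_def)

text \<open>Assumption \<open>D\<close> takes the place of tautness: it says that the maps of
  \<open>F\<close> restrict to the differences. The functor laws are then inherited from
  \<open>F\<close> and from \<open>X + 1\<close>.\<close>

lemma is_functor_Delta:
  assumes F: "is_functor F"
    and D: "\<And>X Y f a. f \<in> X \<rightarrow>\<^sub>E Y \<Longrightarrow> a \<in> fobj (Delta \<iota> p F) X \<Longrightarrow>
      fmap F (plus_one \<iota> p X) (plus_one \<iota> p Y) (plus_one_map \<iota> p X f) a \<in> fobj (Delta \<iota> p F) Y"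
  shows "is_functor (Delta \<iota> p F)"
proof -
  have sub: "fobj (Delta \<iota> p F) X \<subseteq> fobj F (plus_one \<iota> p X)" for X
    by (auto simp: Delta_def)
  have fmap: "fmap (Delta \<iota> p F) X Y f = restrict (fmap F (plus_one \<iota> p X) (plus_one \<iota> p Y)
      (plus_one_map \<iota> p X f)) (fobj (Delta \<iota> p F) X)" for X Y f
    by (simp add: Delta_def)
  have 2: "fmap F (plus_one \<iota> p X) (plus_one \<iota> p X) (plus_one_map \<iota> p X (\<lambda>x\<in>X. x)) a = a"
    if "a \<in> fobj (Delta \<iota> p F) X" for X a
    using F that sub by (auto simp: is_functor_def plus_one_map_id)
  have 3: "fmap F (plus_one \<iota> p X) (plus_one \<iota> p Z) (plus_one_map \<iota> p X (compose X g f)) a =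
      fmap F (plus_one \<iota> p Y) (plus_one \<iota> p Z) (plus_one_map \<iota> p Y g)
        (fmap F (plus_one \<iota> p X) (plus_one \<iota> p Y) (plus_one_map \<iota> p X f) a)"
    if "f \<in> X \<rightarrow>\<^sub>E Y" "g \<in> Y \<rightarrow>\<^sub>E Z" "a \<in> fobj (Delta \<iota> p F) X" for X Y Z f g a
  proof -
    have "fmap F (plus_one \<iota> p X) (plus_one \<iota> p Z)
        (compose (plus_one \<iota> p X) (plus_one_map \<iota> p Y g) (plus_one_map \<iota> p X f)) =
      compose (fobj F (plus_one \<iota> p X))
        (fmap F (plus_one \<iota> p Y) (plus_one \<iota> p Z) (plus_one_map \<iota> p Y g))
        (fmap F (plus_one \<iota> p X) (plus_one \<iota> p Y) (plus_one_map \<iota> p X f))"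
      using F plus_one_map_PiE[OF that(1)] plus_one_map_PiE[OF that(2)]
      unfolding is_functor_def by blast
    moreover have "a \<in> fobj F (plus_one \<iota> p X)"
      using that sub by blast
    ultimately show ?thesis
      by (simp add: plus_one_map_compose[OF that(1)] compose_eq)
  qed
  show ?thesis
    unfolding is_functor_def
  proof (intro conjI allI ballI)
    fix X Y :: "'u set" and f
    assume "f \<in> X \<rightarrow>\<^sub>E Y"
    then show "fmap (Delta \<iota> p F) X Y f \<in> fobj (Delta \<iota> p F) X \<rightarrow>\<^sub>E fobj (Delta \<iota> p F) Y"
      unfolding fmap by (auto simp: D)
  next
    fix X :: "'u set"
    show "fmap (Delta \<iota> p F) X X (\<lambda>x\<in>X. x) = (\<lambda>a\<in>fobj (Delta \<iota> p F) X. a)"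
      unfolding fmap by (intro restrict_ext) (rule 2)
  next
    fix X Y Z :: "'u set" and f g
    assume fg: "f \<in> X \<rightarrow>\<^sub>E Y" "g \<in> Y \<rightarrow>\<^sub>E Z"
    then show "fmap (Delta \<iota> p F) X Z (compose X g f) =
        compose (fobj (Delta \<iota> p F) X) (fmap (Delta \<iota> p F) Y Z g) (fmap (Delta \<iota> p F) X Y f)"
      unfolding fmap compose_def[of "fobj (Delta \<iota> p F) X"]
      by (intro restrict_ext) (simp add: D 3)
  qed
qed

end


section \<open>The difference of the normalized exponential functor\<close>

locale sup_lattice_point = sup_lattice L + disjoint_point \<iota> p
  for L :: "('l, 'm) gorder_scheme" (structure) and \<iota> :: "'u \<Rightarrow> 'u" and p :: 'u
begin

text \<open>Separating the value at \<open>p\<close> turns normalization on \<open>X + 1\<close>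
  into the condition that defines \<open>complement_set\<close>.\<close>

lemma sup_plus_one:
  assumes "w \<in> plus_one \<iota> p X \<rightarrow> carrier L"
  shows "\<Squnion>(w ` plus_one \<iota> p X) = \<Squnion>((\<lambda>x. w (\<iota> x)) ` X) \<squnion> w p"
proof -
  have "w ` plus_one \<iota> p X = insert (w p) ((\<lambda>x. w (\<iota> x)) ` X)"
    by (auto simp: plus_one_def)
  moreover have "w p \<in> carrier L" "(\<lambda>x. w (\<iota> x)) ` X \<subseteq> carrier L"
    using assms by (auto simp: plus_one_def)
  ultimately show ?thesis
    using weak_sup_insert by (simp add: eq_is_equal join_comm)
qed

lemma fmap_normexp_p:
  assumes "w \<in> normexp_obj L (plus_one \<iota> p X)" "f \<in> X \<rightarrow>\<^sub>E Y"
  shows "fmap (normexp L) (plus_one \<iota> p X) (plus_one \<iota> p Y) (plus_one_map \<iota> p X f) w p = w p"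
proof -
  have "{z \<in> plus_one \<iota> p X. plus_one_map \<iota> p X f z = p} = {p}"
    by (auto simp: plus_one_def)
  moreover have "w p \<in> carrier L"
    using assms by (auto simp: normexp_obj_def plus_one_def)
  ultimately show ?thesis
    \<comment> \<open>\<open>plus_one_def\<close> is held back until the fibre has been rewritten,
      since the equation for the fibre mentions \<open>plus_one\<close> itself.\<close>
    using assms by (simp add: normexp_def) (simp add: plus_one_def)
qed

lemma fmap_normexp_\<iota>:
  assumes "w \<in> normexp_obj L (plus_one \<iota> p X)" "f \<in> X \<rightarrow>\<^sub>E Y" "y \<in> Y"
  shows "fmap (normexp L) (plus_one \<iota> p X) (plus_one \<iota> p Y) (plus_one_map \<iota> p X f) w (\<iota> y) =
    \<Squnion>((\<lambda>x. w (\<iota> x)) ` {x \<in> X. f x = y})"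
proof -
  have "{z \<in> plus_one \<iota> p X. plus_one_map \<iota> p X f z = \<iota> y} = \<iota> ` {x \<in> X. f x = y}"
    by (auto simp: plus_one_def)
  then show ?thesis
    using assms by (simp add: normexp_def image_image) (simp add: plus_one_def)
qed

text \<open>The fibre of the inclusion over \<open>p\<close> is empty, which forces the value
  \<open>\<bottom>\<close> there. Conversely, a value \<open>\<bottom>\<close> adds nothing to the
  supremum, so the restriction to \<open>X\<close> is still normalized and is a preimage.\<close>

lemma image_normexp_plus_one_inj:
  "fmap (normexp L) X (plus_one \<iota> p X) (plus_one_inj \<iota> X) ` normexp_obj L X =
    {w \<in> normexp_obj L (plus_one \<iota> p X). w p = \<bottom>}"
proof -
  have j: "plus_one_inj \<iota> X \<in> X \<rightarrow>\<^sub>E plus_one \<iota> p X"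
    by (auto simp: plus_one_inj_def plus_one_def)
  have at_p: "fmap (normexp L) X (plus_one \<iota> p X) (plus_one_inj \<iota> X) v p = \<bottom>"
    if "v \<in> normexp_obj L X" for v
  proof -
    have "{x \<in> X. plus_one_inj \<iota> X x = p} = {}"
      by (auto simp: plus_one_inj_def)
    then have "\<Squnion>(v ` {x \<in> X. plus_one_inj \<iota> X x = p}) = \<bottom>"
      using weak_sup_empty by (simp only: image_empty eq_is_equal)
    then show ?thesis
      using that by (simp add: normexp_def plus_one_def)
  qed
  have at_\<iota>: "fmap (normexp L) X (plus_one \<iota> p X) (plus_one_inj \<iota> X) v (\<iota> x) = v x"
    if "v \<in> normexp_obj L X" "x \<in> X" for v x
  proof -
    have "{x' \<in> X. plus_one_inj \<iota> X x' = \<iota> x} = {x}"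
      using that by (auto simp: plus_one_inj_def)
    then show ?thesis
      using that by (simp add: normexp_def plus_one_def normexp_obj_def PiE_iff)
  qed
  have mem: "fmap (normexp L) X (plus_one \<iota> p X) (plus_one_inj \<iota> X) v \<in> normexp_obj L (plus_one \<iota> p X)"
    if "v \<in> normexp_obj L X" for v
  proof -
    have "fmap (normexp L) X (plus_one \<iota> p X) (plus_one_inj \<iota> X)
        \<in> fobj (normexp L) X \<rightarrow>\<^sub>E fobj (normexp L) (plus_one \<iota> p X)"
      using is_functor_normexp j unfolding is_functor_def by blast
    then show ?thesis
      using that by (auto simp: normexp_def)
  qed
  show ?thesis
  proof (intro equalityI subsetI)
    fix w
    assume "w \<in> {w \<in> normexp_obj L (plus_one \<iota> p X). w p = \<bottom>}"
    then have w: "w \<in> normexp_obj L (plus_one \<iota> p X)" "w p = \<bottom>"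
      by auto
    define v where "v = (\<lambda>x\<in>X. w (\<iota> x))"
    have wX: "(\<lambda>x. w (\<iota> x)) ` X \<subseteq> carrier L"
      using w by (auto simp: normexp_obj_def plus_one_def)
    have "v ` X = (\<lambda>x. w (\<iota> x)) ` X"
      by (auto simp: v_def)
    moreover have "\<Squnion>((\<lambda>x. w (\<iota> x)) ` X) \<squnion> \<bottom> = \<top>"
      using w sup_plus_one[of w X] by (auto simp: normexp_obj_def PiE_iff Pi_iff)
    moreover have "s \<squnion> \<bottom> = s" if "s \<in> carrier L" for s
      using that by (intro le_antisym) (auto intro!: join_le join_left join_closed)
    ultimately have v: "v \<in> normexp_obj L X"
      using wX by (auto simp: normexp_obj_def v_def)
    have "w = fmap (normexp L) X (plus_one \<iota> p X) (plus_one_inj \<iota> X) v"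
    proof (rule extensionalityI)
      show "w \<in> extensional (plus_one \<iota> p X)"
        "fmap (normexp L) X (plus_one \<iota> p X) (plus_one_inj \<iota> X) v \<in> extensional (plus_one \<iota> p X)"
        using w mem[OF v] by (auto simp: normexp_obj_def PiE_iff)
    next
      fix z
      assume "z \<in> plus_one \<iota> p X"
      then show "w z = fmap (normexp L) X (plus_one \<iota> p X) (plus_one_inj \<iota> X) v z"
        using w at_p[OF v] at_\<iota>[OF v] by (auto simp: plus_one_def v_def)
    qed
    with v show "w \<in> fmap (normexp L) X (plus_one \<iota> p X) (plus_one_inj \<iota> X) ` normexp_obj L X"
      by blast
  qed (auto simp: mem at_p)
qed

lemma fobj_Delta_normexp:
  "fobj (Delta \<iota> p (normexp L)) X = {w \<in> normexp_obj L (plus_one \<iota> p X). w p \<noteq> \<bottom>}"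
proof -
  have "fobj (Delta \<iota> p (normexp L)) X = normexp_obj L (plus_one \<iota> p X) -
      fmap (normexp L) X (plus_one \<iota> p X) (plus_one_inj \<iota> X) ` normexp_obj L X"
    by (simp add: Delta_def normexp_def)
  then show ?thesis
    by (auto simp: image_normexp_plus_one_inj)
qed

lemma fmap_Delta_normexp:
  assumes "w \<in> fobj (Delta \<iota> p (normexp L)) X"
  shows "fmap (Delta \<iota> p (normexp L)) X Y f w =
    fmap (normexp L) (plus_one \<iota> p X) (plus_one \<iota> p Y) (plus_one_map \<iota> p X f) w"
  using assms by (simp add: Delta_def)

text \<open>The value at \<open>p\<close> does not change along \<open>f + 1\<close>, so it stays
  different from \<open>\<bottom>\<close>; this verifies the restriction condition directly.\<close>

lemma is_functor_Delta_normexp: "is_functor (Delta \<iota> p (normexp L))"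
proof (rule is_functor_Delta[OF is_functor_normexp])
  fix X Y :: "'u set" and f w
  assume f: "f \<in> X \<rightarrow>\<^sub>E Y" and w: "w \<in> fobj (Delta \<iota> p (normexp L)) X"
  have "fmap (normexp L) (plus_one \<iota> p X) (plus_one \<iota> p Y) (plus_one_map \<iota> p X f)
      \<in> fobj (normexp L) (plus_one \<iota> p X) \<rightarrow>\<^sub>E fobj (normexp L) (plus_one \<iota> p Y)"
    using is_functor_normexp plus_one_map_PiE[OF f] unfolding is_functor_def by blast
  then have "fmap (normexp L) (plus_one \<iota> p X) (plus_one \<iota> p Y) (plus_one_map \<iota> p X f) w
      \<in> normexp_obj L (plus_one \<iota> p Y)"
    using w unfolding fobj_Delta_normexp by (auto simp: normexp_def)
  then show "fmap (normexp L) (plus_one \<iota> p X) (plus_one \<iota> p Y) (plus_one_map \<iota> p X f) w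
      \<in> fobj (Delta \<iota> p (normexp L)) Y"
    using w f by (simp add: fobj_Delta_normexp fmap_normexp_p)
qed

section \<open>The bijection between the difference and the sum, and its naturality\<close>

definition split_point :: "'u set \<Rightarrow> ('u \<Rightarrow> 'l) \<Rightarrow> 'l \<times> 'l \<times> ('u \<Rightarrow> 'l)" where
  "split_point X w = (\<Squnion>((\<lambda>x. w (\<iota> x)) ` X), w p, \<lambda>x\<in>X. w (\<iota> x))"

definition extend_point :: "'u set \<Rightarrow> 'l \<times> 'l \<times> ('u \<Rightarrow> 'l) \<Rightarrow> 'u \<Rightarrow> 'l" where
  "extend_point X =
     (\<lambda>(l, c, v). \<lambda>z\<in>plus_one \<iota> p X. if z = p then c else v (the_inv_into X \<iota> z))"

abbreviation "Parts \<equiv> functor_sum (carrier L) (\<lambda>l. copower (complement_set L l) (normexp (down_set L l)))"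

text \<open>By \<open>normexp_obj_down_set\<close> the last component can be treated as a function
  into \<open>L\<close>, so the proof of bijectivity works in \<open>L\<close> alone; the down-sets
  return only for naturality.\<close>

lemma mem_fobj_Sum:
  "(l, c, v) \<in> fobj Parts X \<longleftrightarrow>
    l \<in> carrier L \<and> c \<in> carrier L \<and> l \<squnion> c = \<top> \<and> c \<noteq> \<bottom> \<and>
    v \<in> X \<rightarrow>\<^sub>E carrier L \<and> \<Squnion>(v ` X) = l"
  by (auto simp: functor_sum_def copower_def normexp_def complement_set_def normexp_obj_down_set)

lemma split_point_mem:
  assumes "w \<in> fobj (Delta \<iota> p (normexp L)) X"
  shows "split_point X w \<in> fobj Parts X"
proof -
  have w: "w \<in> plus_one \<iota> p X \<rightarrow>\<^sub>E carrier L" "\<Squnion>(w ` plus_one \<iota> p X) = \<top>" "w p \<noteq> \<bottom>"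
    using assms by (auto simp: fobj_Delta_normexp normexp_obj_def)
  have "w p \<in> carrier L" "(\<lambda>x. w (\<iota> x)) ` X \<subseteq> carrier L"
    using w by (auto simp: plus_one_def)
  moreover have "(\<lambda>x\<in>X. w (\<iota> x)) ` X = (\<lambda>x. w (\<iota> x)) ` X"
    by auto
  moreover have "\<Squnion>((\<lambda>x. w (\<iota> x)) ` X) \<squnion> w p = \<top>"
    using w sup_plus_one[of w X] by (auto simp: PiE_iff Pi_iff)
  ultimately show ?thesis
    using w unfolding split_point_def mem_fobj_Sum by auto
qed

lemma extend_point_p: "extend_point X (l, c, v) p = c"
  by (simp add: extend_point_def plus_one_def)

lemma extend_point_\<iota>: "x \<in> X \<Longrightarrow> extend_point X (l, c, v) (\<iota> x) = v x"
  by (simp add: extend_point_def plus_one_def)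

lemma extend_point_mem:
  assumes "a \<in> fobj Parts X"
  shows "extend_point X a \<in> fobj (Delta \<iota> p (normexp L)) X"
proof -
  obtain l c v where a: "a = (l, c, v)"
    by (cases a)
  have lcv: "l \<in> carrier L" "c \<in> carrier L" "l \<squnion> c = \<top>" "c \<noteq> \<bottom>"
    "v \<in> X \<rightarrow>\<^sub>E carrier L" "\<Squnion>(v ` X) = l"
    using assms unfolding a mem_fobj_Sum by auto
  have PiE: "extend_point X a \<in> plus_one \<iota> p X \<rightarrow>\<^sub>E carrier L"
    using lcv by (auto simp: a extend_point_def plus_one_def)
  have "(\<lambda>x. extend_point X a (\<iota> x)) ` X = v ` X"
    by (auto simp: a extend_point_\<iota>)
  then have "\<Squnion>(extend_point X a ` plus_one \<iota> p X) = \<top>"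
    using sup_plus_one[of "extend_point X a" X] PiE lcv by (auto simp: a extend_point_p PiE_iff Pi_iff)
  with PiE lcv show ?thesis
    by (simp add: fobj_Delta_normexp normexp_obj_def) (simp add: a extend_point_p)
qed

text \<open>The index is recovered because membership in the sum forces the supremum of
  \<open>v\<close> over \<open>X\<close> to be \<open>l\<close>.\<close>

lemma split_extend_point:
  assumes "a \<in> fobj Parts X"
  shows "split_point X (extend_point X a) = a"
proof -
  obtain l c v where a: "a = (l, c, v)"
    by (cases a)
  have v: "v \<in> X \<rightarrow>\<^sub>E carrier L" "\<Squnion>(v ` X) = l"
    using assms unfolding a mem_fobj_Sum by auto
  have "(\<lambda>x. extend_point X a (\<iota> x)) ` X = v ` X"
    by (auto simp: a extend_point_\<iota>)
  moreover have "(\<lambda>x\<in>X. extend_point X a (\<iota> x)) = v"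
    using v by (intro extensionalityI[of _ X]) (auto simp: a extend_point_\<iota> PiE_iff)
  ultimately show ?thesis
    using v by (simp add: split_point_def) (simp add: a extend_point_p)
qed

lemma extend_split_point:
  assumes "w \<in> fobj (Delta \<iota> p (normexp L)) X"
  shows "extend_point X (split_point X w) = w"
proof (rule extensionalityI[of _ "plus_one \<iota> p X"])
  show "w \<in> extensional (plus_one \<iota> p X)"
    using assms by (auto simp: fobj_Delta_normexp normexp_obj_def PiE_iff)
qed (auto simp: extend_point_def split_point_def plus_one_def)

text \<open>The index is preserved by \<open>sup_fibres\<close> and the value at \<open>p\<close> by
  \<open>fmap_normexp_p\<close>. For the last component it remains to compare suprema in
  \<open>L\<close> with suprema in the down-set of the index.\<close>

lemma split_point_natural:
  assumes f: "f \<in> X \<rightarrow>\<^sub>E Y" and w: "w \<in> fobj (Delta \<iota> p (normexp L)) X"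
  shows "split_point Y (fmap (Delta \<iota> p (normexp L)) X Y f w) = fmap Parts X Y f (split_point X w)"
proof -
  let ?l = "\<Squnion>((\<lambda>x. w (\<iota> x)) ` X)" and ?v = "\<lambda>x\<in>X. w (\<iota> x)"
  let ?w' = "fmap (Delta \<iota> p (normexp L)) X Y f w"
  have obj: "w \<in> normexp_obj L (plus_one \<iota> p X)"
    using w by (simp add: fobj_Delta_normexp)
  have wX: "(\<lambda>x. w (\<iota> x)) \<in> X \<rightarrow> carrier L"
    using obj by (auto simp: normexp_obj_def plus_one_def)
  have mem: "(?l, w p, ?v) \<in> fobj Parts X"
    using split_point_mem[OF w] by (simp add: split_point_def)
  \<comment> \<open>These memberships discharge the guards of the restricted functions in
    \<open>fmap Parts\<close> at this triple.\<close>
  then have v: "?v \<in> normexp_obj (down_set L ?l) X" "w p \<in> complement_set L ?l" "?l \<in> carrier L"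
    by (auto simp: functor_sum_def copower_def normexp_def)
  have w'_p: "?w' p = w p"
    using w obj f by (simp add: fmap_Delta_normexp fmap_normexp_p)
  have w'_\<iota>: "?w' (\<iota> y) = \<Squnion>((\<lambda>x. w (\<iota> x)) ` {x \<in> X. f x = y})" if "y \<in> Y" for y
    using w obj f that by (simp add: fmap_Delta_normexp fmap_normexp_\<iota>)
  have "(\<lambda>y. ?w' (\<iota> y)) ` Y = (\<lambda>y. \<Squnion>((\<lambda>x. w (\<iota> x)) ` {x \<in> X. f x = y})) ` Y"
    using w'_\<iota> by (intro image_cong) auto
  then have sup: "\<Squnion>((\<lambda>y. ?w' (\<iota> y)) ` Y) = ?l"
    using sup_fibres[OF wX, of f Y] f by auto
  \<comment> \<open>The sum pushes forward with suprema in the down-set of \<open>?l\<close>, the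
    difference with suprema in \<open>L\<close>. They agree since all values of \<open>?v\<close>
    lie below \<open>?l\<close>.\<close>
  have fibre: "\<Squnion>\<^bsub>down_set L ?l\<^esub>(?v ` {x \<in> X. f x = y}) = \<Squnion>((\<lambda>x. w (\<iota> x)) ` {x \<in> X. f x = y})" for y
  proof -
    have "?v ` {x \<in> X. f x = y} = (\<lambda>x. w (\<iota> x)) ` {x \<in> X. f x = y}"
      by (intro image_cong) auto
    moreover have "?v ` {x \<in> X. f x = y} \<subseteq> carrier (down_set L ?l)"
      using v(1) by (auto simp: normexp_obj_def)
    ultimately show ?thesis
      using sup_down_set[OF v(3)] by simp
  qed
  have "fmap Parts X Y f (?l, w p, ?v) =
      (?l, w p, \<lambda>y\<in>Y. \<Squnion>\<^bsub>down_set L ?l\<^esub>(?v ` {x \<in> X. f x = y}))"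
    using v by (simp add: functor_sum_def copower_def normexp_def)
  \<comment> \<open>The formula for \<open>?w'\<close> holds only at points of \<open>Y\<close>,
    hence the congruence rule for \<open>restrict\<close>.\<close>
  also have "\<dots> = split_point Y ?w'"
    unfolding split_point_def sup w'_p fibre using w'_\<iota> by (simp cong: restrict_cong)
  finally show ?thesis
    by (simp add: split_point_def)
qed

end

theorem proposition4p6p2:
  fixes L :: "('l, 'm) gorder_scheme"
    and \<iota> :: "'u \<Rightarrow> 'u" and p :: 'u
  assumes "sup_lattice L"
    and "inj \<iota>" and "p \<notin> range \<iota>"
  shows "functor_iso (Delta \<iota> p (normexp L))
           (functor_sum (carrier L) (\<lambda>l. copower (complement_set L l) (normexp (down_set L l))))"
proof -
  interpret sup_lattice_point L \<iota> p
    using assms by (intro sup_lattice_point.intro disjoint_point.intro)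
  have "is_functor Parts"
    \<comment> \<open>Each summand is a functor because a down-set is itself a sup-lattice, so
      \<open>is_functor_normexp\<close> applies to it as base.\<close>
    by (intro is_functor_sum is_functor_copower sup_lattice.is_functor_normexp down_set_sup_lattice)
  moreover have "bij_betw (split_point X) (fobj (Delta \<iota> p (normexp L)) X) (fobj Parts X)" for X
    by (rule bij_betw_byWitness[where f' = "extend_point X"])
      (auto simp: extend_split_point split_extend_point split_point_mem extend_point_mem)
  ultimately show ?thesis
    unfolding functor_iso_def using is_functor_Delta_normexp split_point_natural by blast
qed

end
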